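(* Let $f:(\{0,1\}^n)^k\to\{0,1\}$ be a symmetric $k$-argument function, $G=([k],E)$ a restriction graph, $Q$ an oblivious $\mathrm{NOF}_G$ protocol computing $f$, and $S$ an $\ell$-filtering set for $G$. Then $$D^{\mathrm{NOF}}(f^{\ell})\le \ell\cdot D^{\mathrm{NOF}_G}(Q)+\ell-\sum_{(a,b,B)\in S}|B|\cdot W_Q(a,b).$$
   Context: $f$ is symmetric if $f(x_1,\dots,x_k)=f(x_{\pi(1)},\dots,x_{\pi(k)})$ for every permutation $\pi$ of $[k]$ and every input. NOF model and $D^{\mathrm{NOF}}$: $k$ parties; input $x_j\in\{0,1\}^n$ is seen by all parties except $P_j$; parties write bits on a shared board; all parties must learn the output; $D^{\mathrm{NOF}}(g)$ is the minimum over deterministic NOF protocols for $g$ of the worst-case number of bits written. $f^{\ell}$: computing $f$ on $\ell$ independent instances, where the $j$-th argument $x_{i,j}$ of instance $i$ is on $P_j$'s forehead; all parties must learn all $\ell$ outputs. Restricted model: a restriction graph is a simple directed graph $G=(V,E)$ on $V=[k]$ (no loops). In the $\mathrm{NOF}_G$ model, party $P_i$ sees input $x_j$ iff $(i,j)\in E$. Communication is over private point-to-point channels between every pair of parties, in rounds: in round $t+1$ each $P_i$ may send to each $P_j$ a message depending on the messages $P_i$ received in rounds $1,\dots,t$ and on the inputs $P_i$ sees. A $\mathrm{NOF}_G$ protocol computes $f$ if some fixed designated party outputs $f(\vec x)$. $N(a)=N_G(a)=\{j:(a,j)\in E\}$ and $\overline{N}(a)=[k]\setminus N(a)$. A protocol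 $Q$ is oblivious if the length of the message from $P_i$ to $P_j$ in round $t$ is the same on every input. For oblivious $Q$, $W_Q(a,b)$ is the total number of bits sent from $P_a$ to $P_b$ in $Q$, and $D^{\mathrm{NOF}_G}(Q)$ is the total number of bits sent in $Q$. A filtering set for $G$ is a set $S\subseteq\{(a,b,B): a\ne b\in[k],\ B\subseteq\overline{N}(a),\ a,b\notin B\}$ such that for any two distinct $(a,b,B),(a',b',B')\in S$: $a\notin\{b'\}\cup B'$ and $(\{b\}\cup B)\cap(\{b'\}\cup B')=\emptyset$. Let $R(S)=\max_{a\in[k]}\sum_{(a,b',B')\in S}|B'|$ (sum over triples in $S$ with first coordinate $a$). $S$ is an $\ell$-filtering set if it is a filtering set with $R(S)\le \ell-1$. *)

theory Defs
  imports
    "HOL-Library.FuncSet"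
    "HOL-Library.Extended_Real"
    "HOL-Combinatorics.Permutations"
begin

section \<open>Inputs\<close>

text \<open>
  The parties are \<open>1, \<dots>, k\<close>. An input vector with arguments from \<open>A\<close> is an extensional function
  on \<open>{1..k}\<close>, and \<open>restrict x V\<close> is the part of \<open>x\<close> that is visible to a party who sees exactly
  the arguments with index in \<open>V\<close>.
\<close>

abbreviation parties :: "nat \<Rightarrow> nat set" where
  "parties k \<equiv> {1..k}"

definition words :: "nat \<Rightarrow> bool list set" where
  "words n = {w. length w = n}"

definition inputs :: "nat \<Rightarrow> 'x set \<Rightarrow> (nat \<Rightarrow> 'x) set" where
  "inputs k A = parties k \<rightarrow>\<^sub>E A"

definition symmetric_fun :: "nat \<Rightarrow> nat \<Rightarrow> ((nat \<Rightarrow> bool list) \<Rightarrow> bool) \<Rightarrow> bool" where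
  "symmetric_fun k n f \<longleftrightarrow>
     (\<forall>\<pi> x. \<pi> permutes parties k \<longrightarrow> x \<in> inputs k (words n) \<longrightarrow> f (\<lambda>j. x (\<pi> j)) = f x)"

section \<open>Number-on-the-forehead protocols\<close>

text \<open>
  A deterministic protocol is a tree whose nodes are the possible contents of the board. At
  \<open>Speak i m next\<close> party \<open>i\<close> writes the bit \<open>m\<close> of what it sees, and the protocol continues with
  the corresponding subtree. At \<open>Halt out\<close> each party \<open>j\<close> produces its own output \<open>out j\<close> from what
  it sees; so this output depends on the board and on the arguments visible to \<open>j\<close>.
\<close>

datatype ('x, 'o) nof_protocol =
    Halt "nat \<Rightarrow> (nat \<Rightarrow> 'x) \<Rightarrow> 'o"
  | Speak nat "(nat \<Rightarrow> 'x) \<Rightarrow> bool" "bool \<Rightarrow> ('x, 'o) nof_protocol"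

definition nof_view :: "nat \<Rightarrow> nat \<Rightarrow> (nat \<Rightarrow> 'x) \<Rightarrow> nat \<Rightarrow> 'x" where
  "nof_view k i x = restrict x (parties k - {i})"

primrec speakers :: "('x, 'o) nof_protocol \<Rightarrow> nat set" where
  "speakers (Halt out) = {}"
| "speakers (Speak i m next) = insert i (\<Union>b. speakers (next b))"

primrec board :: "nat \<Rightarrow> ('x, 'o) nof_protocol \<Rightarrow> (nat \<Rightarrow> 'x) \<Rightarrow> bool list" where
  "board k (Halt out) x = []"
| "board k (Speak i m next) x = m (nof_view k i x) # board k (next (m (nof_view k i x))) x"

primrec nof_output :: "nat \<Rightarrow> ('x, 'o) nof_protocol \<Rightarrow> (nat \<Rightarrow> 'x) \<Rightarrow> nat \<Rightarrow> 'o" where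
  "nof_output k (Halt out) x j = out j (nof_view k j x)"
| "nof_output k (Speak i m next) x j = nof_output k (next (m (nof_view k i x))) x j"

definition nof_computes ::
  "nat \<Rightarrow> 'x set \<Rightarrow> ('x, 'o) nof_protocol \<Rightarrow> ((nat \<Rightarrow> 'x) \<Rightarrow> 'o) \<Rightarrow> bool" where
  "nof_computes k A P g \<longleftrightarrow>
     speakers P \<subseteq> parties k \<and>
     (\<forall>x\<in>inputs k A. \<forall>j\<in>parties k. nof_output k P x j = g x)"

definition nof_cost :: "nat \<Rightarrow> 'x set \<Rightarrow> ('x, 'o) nof_protocol \<Rightarrow> enat" where
  "nof_cost k A P = (SUP x\<in>inputs k A. enat (length (board k P x)))"

text \<open>The value is \<open>\<infinity>\<close> if no protocol computes \<open>g\<close>, as for \<open>k = 1\<close> and a non-constant \<open>g\<close>.\<close>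

definition D_NOF :: "nat \<Rightarrow> 'x set \<Rightarrow> ((nat \<Rightarrow> 'x) \<Rightarrow> 'o) \<Rightarrow> enat" where
  "D_NOF k A g = (INF P\<in>{P. nof_computes k A P g}. nof_cost k A P)"

text \<open>
  In \<open>f\<^sup>l\<close> the forehead of party \<open>j\<close> carries the list of its arguments in the \<open>l\<close> instances.
\<close>

definition multi_words :: "nat \<Rightarrow> nat \<Rightarrow> bool list list set" where
  "multi_words l n = {ws. length ws = l \<and> set ws \<subseteq> words n}"

definition multi_fun ::
  "nat \<Rightarrow> nat \<Rightarrow> ((nat \<Rightarrow> bool list) \<Rightarrow> bool) \<Rightarrow> (nat \<Rightarrow> bool list list) \<Rightarrow> bool list" where
  "multi_fun k l f X = map (\<lambda>i. f (\<lambda>j\<in>parties k. X j ! i)) [0..<l]"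

section \<open>Protocols restricted by a graph\<close>

definition restriction_graph :: "nat \<Rightarrow> (nat \<times> nat) set \<Rightarrow> bool" where
  "restriction_graph k E \<longleftrightarrow> E \<subseteq> parties k \<times> parties k \<and> irrefl E"

definition nbrs :: "(nat \<times> nat) set \<Rightarrow> nat \<Rightarrow> nat set" where
  "nbrs E a = {j. (a, j) \<in> E}"

definition non_nbrs :: "nat \<Rightarrow> (nat \<times> nat) set \<Rightarrow> nat \<Rightarrow> nat set" where
  "non_nbrs k E a = parties k - nbrs E a"

text \<open>
  The history of a party is the list of the rounds so far; each round is the function that maps a
  sender to the message received from it, \<open>[]\<close> meaning that nothing was sent. In
  \<open>send Q i j v h\<close>, the message from \<open>i\<close> to \<open>j\<close>, \<open>v\<close> is what \<open>i\<close> sees and \<open>h\<close> is its history;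
  the number of the round is \<open>length h + 1\<close>.
\<close>

type_synonym history = "(nat \<Rightarrow> bool list) list"

record restricted_protocol =
  rounds :: nat
  send :: "nat \<Rightarrow> nat \<Rightarrow> (nat \<Rightarrow> bool list) \<Rightarrow> history \<Rightarrow> bool list"
  designated :: nat
  result :: "(nat \<Rightarrow> bool list) \<Rightarrow> history \<Rightarrow> bool"

definition graph_view :: "(nat \<times> nat) set \<Rightarrow> nat \<Rightarrow> (nat \<Rightarrow> bool list) \<Rightarrow> nat \<Rightarrow> bool list" where
  "graph_view E i x = restrict x (nbrs E i)"

primrec received ::
  "nat \<Rightarrow> (nat \<times> nat) set \<Rightarrow> restricted_protocol \<Rightarrow> (nat \<Rightarrow> bool list) \<Rightarrow> nat \<Rightarrow> nat \<Rightarrow> history" where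
  "received k E Q x 0 i = []"
| "received k E Q x (Suc t) i =
     received k E Q x t i @
     [\<lambda>j. if j \<in> parties k - {i} then send Q j i (graph_view E j x) (received k E Q x t j) else []]"

definition message ::
  "nat \<Rightarrow> (nat \<times> nat) set \<Rightarrow> restricted_protocol \<Rightarrow> (nat \<Rightarrow> bool list) \<Rightarrow> nat \<Rightarrow> nat \<Rightarrow> nat \<Rightarrow> bool list"
where
  "message k E Q x t i j = send Q i j (graph_view E i x) (received k E Q x t i)"

definition restricted_computes ::
  "nat \<Rightarrow> nat \<Rightarrow> (nat \<times> nat) set \<Rightarrow> restricted_protocol \<Rightarrow> ((nat \<Rightarrow> bool list) \<Rightarrow> bool) \<Rightarrow> bool" where
  "restricted_computes k n E Q f \<longleftrightarrow>
     designated Q \<in> parties k \<and>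
     (\<forall>x\<in>inputs k (words n).
        result Q (graph_view E (designated Q) x) (received k E Q x (rounds Q) (designated Q)) = f x)"

definition oblivious :: "nat \<Rightarrow> nat \<Rightarrow> (nat \<times> nat) set \<Rightarrow> restricted_protocol \<Rightarrow> bool" where
  "oblivious k n E Q \<longleftrightarrow>
     (\<forall>t<rounds Q. \<forall>i\<in>parties k. \<forall>j\<in>parties k - {i}.
        \<forall>x\<in>inputs k (words n). \<forall>y\<in>inputs k (words n).
          length (message k E Q x t i j) = length (message k E Q y t i j))"

definition channel_bits ::
  "nat \<Rightarrow> (nat \<times> nat) set \<Rightarrow> restricted_protocol \<Rightarrow> (nat \<Rightarrow> bool list) \<Rightarrow> nat \<Rightarrow> nat \<Rightarrow> nat" where
  "channel_bits k E Q x a b = (\<Sum>t<rounds Q. length (message k E Q x t a b))"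

text \<open>
  For an oblivious protocol the numbers of bits do not depend on the input, so \<open>W\<close> and
  \<open>D_restricted\<close> are their common values over all inputs.
\<close>

definition W :: "nat \<Rightarrow> nat \<Rightarrow> (nat \<times> nat) set \<Rightarrow> restricted_protocol \<Rightarrow> nat \<Rightarrow> nat \<Rightarrow> nat" where
  "W k n E Q a b = (THE w. \<forall>x\<in>inputs k (words n). channel_bits k E Q x a b = w)"

definition D_restricted :: "nat \<Rightarrow> nat \<Rightarrow> (nat \<times> nat) set \<Rightarrow> restricted_protocol \<Rightarrow> nat" where
  "D_restricted k n E Q =
     (THE d. \<forall>x\<in>inputs k (words n).
        (\<Sum>a\<in>parties k. \<Sum>b\<in>parties k - {a}. channel_bits k E Q x a b) = d)"

lemma zero_input: "(\<lambda>j\<in>parties k. replicate n False) \<in> inputs k (words n)"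
  by (auto simp: inputs_def words_def)

lemma W_eq:
  assumes "oblivious k n E Q" "a \<in> parties k" "b \<in> parties k" "a \<noteq> b" "x \<in> inputs k (words n)"
  shows "W k n E Q a b = channel_bits k E Q x a b"
proof -
  have "channel_bits k E Q y a b = channel_bits k E Q x a b" if "y \<in> inputs k (words n)" for y
    unfolding channel_bits_def
  proof (rule sum.cong[OF refl])
    fix t assume "t \<in> {..<rounds Q}"
    then show "length (message k E Q y t a b) = length (message k E Q x t a b)"
      using assms that unfolding oblivious_def by blast
  qed
  then show ?thesis unfolding W_def using assms(5) by (intro the_equality) metis+
qed

lemma D_restricted_eq:
  assumes "oblivious k n E Q"
  shows "D_restricted k n E Q = (\<Sum>a\<in>parties k. \<Sum>b\<in>parties k - {a}. W k n E Q a b)"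
proof -
  have "(\<Sum>a\<in>parties k. \<Sum>b\<in>parties k - {a}. channel_bits k E Q x a b) =
        (\<Sum>a\<in>parties k. \<Sum>b\<in>parties k - {a}. W k n E Q a b)" if "x \<in> inputs k (words n)" for x
    using W_eq[OF assms _ _ _ that] by (intro sum.cong refl) auto
  then show ?thesis
    unfolding D_restricted_def using zero_input[where k = k and n = n]
    by (intro the_equality) fastforce+
qed

section \<open>Filtering sets\<close>

definition filtering_set :: "nat \<Rightarrow> (nat \<times> nat) set \<Rightarrow> (nat \<times> nat \<times> nat set) set \<Rightarrow> bool" where
  "filtering_set k E S \<longleftrightarrow>
     S \<subseteq> {(a, b, B). a \<in> parties k \<and> b \<in> parties k \<and> a \<noteq> b \<and>
                       B \<subseteq> non_nbrs k E a \<and> a \<notin> B \<and> b \<notin> B} \<and>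
     (\<forall>(a, b, B)\<in>S. \<forall>(a', b', B')\<in>S. (a, b, B) \<noteq> (a', b', B') \<longrightarrow>
        a \<notin> {b'} \<union> B' \<and> ({b} \<union> B) \<inter> ({b'} \<union> B') = {})"

definition R :: "nat \<Rightarrow> (nat \<times> nat \<times> nat set) set \<Rightarrow> nat" where
  "R k S = Max ((\<lambda>a. \<Sum>(a', b', B')\<in>{s \<in> S. fst s = a}. card B') ` parties k)"

definition l_filtering_set ::
  "nat \<Rightarrow> nat \<Rightarrow> (nat \<times> nat) set \<Rightarrow> (nat \<times> nat \<times> nat set) set \<Rightarrow> bool" where
  "l_filtering_set l k E S \<longleftrightarrow> filtering_set k E S \<and> int (R k S) \<le> int l - 1"

end

theory Submission
  imports Defs
begin

text \<open>
  Since \<open>f\<close> is symmetric, the roles of \<open>Q\<close> can be distributed differently in each instance. For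
  \<open>(a, b, B) \<in> S\<close>, role \<open>a\<close> always stays with party \<open>a\<close>, and in the instances \<open>0, \<dots>, card B\<close>
  the role \<open>b\<close> is played in turn by each member of \<open>{b} \<union> B\<close>, the others taking the roles in \<open>B\<close>.
  Role \<open>a\<close> does not see these, and all messages to it are on the board, so each member of
  \<open>{b} \<union> B\<close> can compute the messages from \<open>a\<close> to \<open>b\<close> in all these instances but the one in which
  it plays \<open>b\<close> itself. Hence it suffices to write the bitwise sum modulo 2 of the \<open>card B + 1\<close>
  messages. The first components of the triples being distinct from all members of these sets, and
  the sets being disjoint, all triples can be treated at once.
\<close>

section \<open>Protocols from families of bits\<close>

text \<open>A bit can be written once all bits of smaller rank are on the board. The set
  \<open>X\<close> stands for the inputs still consistent with the board; it is arbitrary because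
  each written bit shrinks it in the induction.\<close>

lemma nof_protocol_of_bits:
  fixes bit :: "'i \<Rightarrow> (nat \<Rightarrow> 'x) \<Rightarrow> bool" and rank :: "'i \<Rightarrow> nat"
  assumes "finite I" and "speaker ` I \<subseteq> parties k"
    and "\<And>p x y. p \<in> I \<Longrightarrow> x \<in> X \<Longrightarrow> y \<in> X \<Longrightarrow>
      nof_view k (speaker p) x = nof_view k (speaker p) y \<Longrightarrow>
      (\<And>q. q \<in> I \<Longrightarrow> rank q < rank p \<Longrightarrow> bit q x = bit q y) \<Longrightarrow> bit p x = bit p y"
    and "\<And>x y. x \<in> X \<Longrightarrow> y \<in> X \<Longrightarrow> (\<And>q. q \<in> I \<Longrightarrow> bit q x = bit q y) \<Longrightarrow> g x = g y"
  shows "\<exists>P. speakers P \<subseteq> parties k \<and>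
    (\<forall>x\<in>X. length (board k P x) = card I \<and> (\<forall>j. nof_output k P x j = g x))"
  using assms
proof (induction "card I" arbitrary: I X)
  case 0
  have "I = {}" using "0.hyps" "0.prems"(1) by simp
  have const: "g x = g y" if "x \<in> X" "y \<in> X" for x y
  proof (rule "0.prems"(4)[OF that])
    fix q assume "q \<in> I"
    then show "bit q x = bit q y" using \<open>I = {}\<close> by simp
  qed
  \<comment> \<open>For empty \<open>X\<close> the chosen value is arbitrary and harmless.\<close>
  have "g (SOME x. x \<in> X) = g y" if "y \<in> X" for y
    by (rule const[OF someI[of "\<lambda>x. x \<in> X", OF that] that])
  then show ?case
    using \<open>I = {}\<close> by (intro exI[of _ "Halt (\<lambda>j v. g (SOME x. x \<in> X))"]) simp
next
  case (Suc m)
  have "I \<noteq> {}" using Suc.hyps(2) by (metis card.empty nat.distinct(1))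
  \<comment> \<open>A bit of least rank depends on the view of its speaker alone, so it can be written first;
    then each half of \<open>X\<close> is handled by induction.\<close>
  then obtain p where p: "p \<in> I" and min: "\<And>q. q \<in> I \<Longrightarrow> rank p \<le> rank q"
    using arg_min_if_finite(1)[OF Suc.prems(1)] arg_min_least[OF Suc.prems(1)] by blast
  have own: "bit p x = bit p y"
    if "x \<in> X" "y \<in> X" "nof_view k (speaker p) x = nof_view k (speaker p) y" for x y
  proof (rule Suc.prems(3)[OF p that])
    fix q assume "q \<in> I" "rank q < rank p"
    then show "bit q x = bit q y" using min[of q] by simp
  qed
  have "\<forall>c. \<exists>P. speakers P \<subseteq> parties k \<and>
    (\<forall>x\<in>{x \<in> X. bit p x = c}. length (board k P x) = card (I - {p}) \<and>
      (\<forall>j. nof_output k P x j = g x))"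
  proof (rule allI, rule Suc.hyps(1))
    fix c
    show "m = card (I - {p})" using Suc.hyps(2) p Suc.prems(1) by simp
    show "finite (I - {p})" using Suc.prems(1) by simp
    show "speaker ` (I - {p}) \<subseteq> parties k" using Suc.prems(2) by auto
    show "bit r x = bit r y"
      if "r \<in> I - {p}" "x \<in> {x \<in> X. bit p x = c}" "y \<in> {x \<in> X. bit p x = c}"
        "nof_view k (speaker r) x = nof_view k (speaker r) y"
        "\<And>q. q \<in> I - {p} \<Longrightarrow> rank q < rank r \<Longrightarrow> bit q x = bit q y" for r x y
    proof (rule Suc.prems(3)[OF _ _ _ that(4)])
      fix q assume "q \<in> I" "rank q < rank r"
      then show "bit q x = bit q y" using that(2,3) that(5)[of q] by (cases "q = p") simp_all
    qed (use that(1-3) in simp_all)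
    show "g x = g y"
      if "x \<in> {x \<in> X. bit p x = c}" "y \<in> {x \<in> X. bit p x = c}"
        "\<And>q. q \<in> I - {p} \<Longrightarrow> bit q x = bit q y" for x y
    proof (rule Suc.prems(4))
      fix q assume "q \<in> I"
      then show "bit q x = bit q y" using that(1,2) that(3)[of q] by (cases "q = p") simp_all
    qed (use that(1,2) in simp_all)
  qed
  from choice[OF this] obtain next_p where
    next_p: "\<And>c. speakers (next_p c) \<subseteq> parties k \<and>
      (\<forall>x\<in>{x \<in> X. bit p x = c}. length (board k (next_p c) x) = card (I - {p}) \<and>
        (\<forall>j. nof_output k (next_p c) x j = g x))"
    by blast
  \<comment> \<open>\<open>bit p\<close> takes the whole input; by \<open>own\<close> it factors on
    \<open>X\<close> through the speaker's view, and \<open>say\<close> is this factor.\<close>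
  define say where "say v \<longleftrightarrow> (\<exists>x\<in>X. nof_view k (speaker p) x = v \<and> bit p x)" for v
  have say: "say (nof_view k (speaker p) x) = bit p x" if "x \<in> X" for x
    unfolding say_def using own[OF _ that] that by blast
  have "speakers (Speak (speaker p) say next_p) \<subseteq> parties k"
    using next_p p Suc.prems(2) by auto
  moreover have "length (board k (Speak (speaker p) say next_p) x) = card I" if "x \<in> X" for x
    using next_p[of "bit p x"] that say[OF that] p Suc.prems(1) Suc.hyps(2) by simp
  moreover have "nof_output k (Speak (speaker p) say next_p) x j = g x" if "x \<in> X" for x j
    using next_p[of "bit p x"] that say[OF that] by simp
  ultimately show ?case by blast
qed

lemma D_NOF_le_card_bits:
  fixes bit :: "'i \<Rightarrow> (nat \<Rightarrow> 'x) \<Rightarrow> bool" and rank :: "'i \<Rightarrow> nat"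
  assumes "finite I" and "speaker ` I \<subseteq> parties k"
    and "\<And>p x y. p \<in> I \<Longrightarrow> x \<in> inputs k A \<Longrightarrow> y \<in> inputs k A \<Longrightarrow>
      nof_view k (speaker p) x = nof_view k (speaker p) y \<Longrightarrow>
      (\<And>q. q \<in> I \<Longrightarrow> rank q < rank p \<Longrightarrow> bit q x = bit q y) \<Longrightarrow> bit p x = bit p y"
    and "\<And>x y. x \<in> inputs k A \<Longrightarrow> y \<in> inputs k A \<Longrightarrow>
      (\<And>q. q \<in> I \<Longrightarrow> bit q x = bit q y) \<Longrightarrow> g x = g y"
  shows "D_NOF k A g \<le> enat (card I)"
proof -
  have "\<exists>P. speakers P \<subseteq> parties k \<and>
    (\<forall>x\<in>inputs k A. length (board k P x) = card I \<and> (\<forall>j. nof_output k P x j = g x))"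
    by (rule nof_protocol_of_bits[where bit = bit and rank = rank and speaker = speaker])
      (fact assms)+
  then obtain P where P: "speakers P \<subseteq> parties k"
    "\<And>x. x \<in> inputs k A \<Longrightarrow> length (board k P x) = card I"
    "\<And>x j. x \<in> inputs k A \<Longrightarrow> nof_output k P x j = g x"
    by blast
  have "nof_computes k A P g" using P unfolding nof_computes_def by blast
  then have "D_NOF k A g \<le> nof_cost k A P" unfolding D_NOF_def by (intro INF_lower) simp
  also have "\<dots> \<le> enat (card I)" unfolding nof_cost_def by (rule SUP_least) (simp add: P)
  finally show ?thesis .
qed

section \<open>Permuting the roles\<close>

text \<open>Swapping \<open>b\<close> with each element of an enumeration of
  \<open>insert b B\<close> sends \<open>b\<close> to distinct places. Beyond \<open>card B\<close>
  the identity is used, so that every instance gets a permutation.\<close>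

lemma permutes_family_distinct_images:
  assumes "finite B" "b \<notin> B"
  shows "\<exists>\<tau> :: nat \<Rightarrow> 'a \<Rightarrow> 'a. (\<forall>i. \<tau> i permutes insert b B) \<and> inj_on (\<lambda>i. \<tau> i b) {..card B}"
proof -
  obtain h where h: "bij_betw h {0..<card (insert b B)} (insert b B)"
    using ex_bij_betw_nat_finite[of "insert b B"] assms by auto
  moreover have "{0..<card (insert b B)} = {..card B}" using assms by auto
  ultimately have h: "bij_betw h {..card B} (insert b B)" by simp
  define \<tau> where "\<tau> i = (if i \<le> card B then transpose b (h i) else id)" for i
  have "\<tau> i permutes insert b B" for i
    using bij_betwE[OF h] by (auto simp: \<tau>_def permutes_id intro!: permutes_swap_id)
  moreover have "inj_on (\<lambda>i. \<tau> i b) {..card B}"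
    using bij_betw_imp_inj_on[OF h] by (auto simp: \<tau>_def inj_on_def)
  ultimately show ?thesis by blast
qed

lemma permutes_disjoint_family:
  assumes "finite A" "\<And>s. s \<in> S \<Longrightarrow> C s \<subseteq> A" "\<And>s. s \<in> S \<Longrightarrow> \<tau> s permutes C s"
    and disj: "\<And>s s' v. s \<in> S \<Longrightarrow> s' \<in> S \<Longrightarrow> v \<in> C s \<Longrightarrow> v \<in> C s' \<Longrightarrow> s = s'"
  shows "\<exists>p. p permutes A \<and> (\<forall>s\<in>S. \<forall>v\<in>C s. p v = \<tau> s v) \<and>
    (\<forall>v. (\<forall>s\<in>S. v \<notin> C s) \<longrightarrow> p v = v)"
proof -
  define p where "p v = (if \<exists>s\<in>S. v \<in> C s then \<tau> (THE s. s \<in> S \<and> v \<in> C s) v else v)" for v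
  have on: "p v = \<tau> s v" if "s \<in> S" "v \<in> C s" for s v
  proof -
    have "(THE s. s \<in> S \<and> v \<in> C s) = s" using that disj by blast
    then show ?thesis using that unfolding p_def by auto
  qed
  have off: "p v = v" if "\<forall>s\<in>S. v \<notin> C s" for v using that unfolding p_def by auto
  \<comment> \<open>\<open>p\<close> neither leaves nor enters any \<open>C s\<close>. So two points
    with equal image lie in the same sets, and injectivity reduces to that of a single
    \<open>\<tau> s\<close>; finiteness of \<open>A\<close> then gives surjectivity.\<close>
  have stays: "p v \<in> C s \<longleftrightarrow> v \<in> C s" if "s \<in> S" for s v
  proof (cases "\<exists>s'\<in>S. v \<in> C s'")
    case True
    then obtain s' where s': "s' \<in> S" "v \<in> C s'" by blast
    then have "p v \<in> C s'" using on assms(3) permutes_in_image by metis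
    then show ?thesis using s' disj that by metis
  next
    case False
    then show ?thesis using off by auto
  qed
  have inj: "v = w" if eq: "p v = p w" for v w
  proof (cases "\<exists>s\<in>S. v \<in> C s")
    case True
    then obtain s where s: "s \<in> S" "v \<in> C s" by blast
    then have "w \<in> C s" using eq stays by metis
    then have "\<tau> s v = \<tau> s w" using eq s on by metis
    then show ?thesis using assms(3)[OF s(1)] permutes_inj by (metis injD)
  next
    case False
    then have "\<forall>s\<in>S. w \<notin> C s" using eq stays by metis
    then show ?thesis using False off eq by metis
  qed
  have "p v \<in> A" if "v \<in> A" for v
    using that off stays assms(2) by (metis subsetD)
  then have "p ` A = A"
    using endo_inj_surj[OF assms(1), of p] inj by (metis image_subsetI inj_onI)
  then have "bij_betw p A A" using inj by (auto simp: bij_betw_def intro: inj_onI)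
  moreover have "p v = v" if "v \<notin> A" for v using that off assms(2) by blast
  ultimately have "p permutes A" by (rule bij_imp_permutes)
  with on off show ?thesis by blast
qed

text \<open>The sets \<open>insert b B\<close> are disjoint, so permutations of them can be
  combined, and the first components lie outside all of them. Since \<open>b\<close> has distinct
  images in the instances up to \<open>card B\<close>, the player of \<open>b\<close> in one of
  these has a role other than \<open>b\<close>, from the same set, in each of the others.\<close>

lemma filtering_set_permutations:
  assumes "filtering_set k E S"
  shows "\<exists>\<sigma> :: nat \<Rightarrow> nat \<Rightarrow> nat. (\<forall>i. \<sigma> i permutes parties k) \<and>
    (\<forall>(a, b, B)\<in>S. \<forall>i. \<sigma> i a = a) \<and>
    (\<forall>(a, b, B)\<in>S. \<forall>i\<le>card B. \<forall>j\<le>card B. \<forall>v. i \<noteq> j \<longrightarrow> \<sigma> j v = \<sigma> i b \<longrightarrow> v \<in> B)"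
proof -
  define C where "C = (\<lambda>(a :: nat, b :: nat, B). insert b B)"
  have S: "a \<in> parties k" "b \<in> parties k" "a \<noteq> b" "B \<subseteq> parties k" "a \<notin> B" "b \<notin> B"
    if "(a, b, B) \<in> S" for a b B
    using assms that unfolding filtering_set_def non_nbrs_def by blast+
  have disj: "s = s'" if "s \<in> S" "s' \<in> S" "v \<in> C s" "v \<in> C s'" for s s' v
    using assms that unfolding filtering_set_def C_def by fastforce
  \<comment> \<open>For the triple of \<open>a\<close> itself this is \<open>a \<noteq> b\<close>
    and \<open>a \<notin> B\<close>; for any other triple it is the filtering condition.\<close>
  have first: "a \<notin> C s" if "(a, b, B) \<in> S" "s \<in> S" for a b B s
    using assms that S[OF that(1)] unfolding filtering_set_def C_def by fastforce
  have "\<exists>\<tau> :: nat \<Rightarrow> nat \<Rightarrow> nat. (\<forall>i. \<tau> i permutes C s) \<and>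
    inj_on (\<lambda>i. \<tau> i (fst (snd s))) {..card (snd (snd s))}" if "s \<in> S" for s
  proof -
    obtain a b B where s: "s = (a, b, B)" by (cases s) auto
    have "finite B" using S(4)[of a b B] that s by (auto intro: finite_subset)
    then show ?thesis
      using permutes_family_distinct_images[of B b] S(6)[of a b B] that s unfolding C_def by simp
  qed
  then obtain \<tau> :: "nat \<times> nat \<times> nat set \<Rightarrow> nat \<Rightarrow> nat \<Rightarrow> nat"
    where \<tau>: "\<And>s i. s \<in> S \<Longrightarrow> \<tau> s i permutes C s"
      "\<And>s. s \<in> S \<Longrightarrow> inj_on (\<lambda>i. \<tau> s i (fst (snd s))) {..card (snd (snd s))}"
    by metis
  have "\<exists>p. p permutes parties k \<and> (\<forall>s\<in>S. \<forall>v\<in>C s. p v = \<tau> s i v) \<and>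
    (\<forall>v. (\<forall>s\<in>S. v \<notin> C s) \<longrightarrow> p v = v)" for i
  proof (rule permutes_disjoint_family)
    show "C s \<subseteq> parties k" if "s \<in> S" for s
      using that S(2,4) unfolding C_def by (cases s) fastforce
  qed (use \<tau>(1) disj in auto)
  then obtain \<sigma> where \<sigma>: "\<And>i. \<sigma> i permutes parties k"
    "\<And>i s v. s \<in> S \<Longrightarrow> v \<in> C s \<Longrightarrow> \<sigma> i v = \<tau> s i v"
    "\<And>i v. (\<forall>s\<in>S. v \<notin> C s) \<Longrightarrow> \<sigma> i v = v"
    by metis
  have "v \<in> B"
    if s: "(a, b, B) \<in> S" and "i \<le> card B" "j \<le> card B" "i \<noteq> j" "\<sigma> j v = \<sigma> i b"
    for a b B i j v
  proof -
    have b: "b \<in> C (a, b, B)" unfolding C_def by simp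
    have "\<sigma> i b \<in> C (a, b, B)"
      using \<sigma>(2)[OF s b] permutes_in_image[OF \<tau>(1)[OF s]] b by metis
    then obtain w where w: "w \<in> C (a, b, B)" "\<tau> (a, b, B) j w = \<sigma> i b"
      using permutes_image[OF \<tau>(1)[OF s, of j]] by (metis imageE)
    then have "\<sigma> j w = \<sigma> j v" using \<sigma>(2)[OF s w(1)] that by simp
    then have "v = w" using permutes_inj[OF \<sigma>(1)] by (metis injD)
    moreover have "\<tau> (a, b, B) i b \<noteq> \<tau> (a, b, B) j b"
      using \<tau>(2)[OF s] that by (auto dest: inj_onD)
    then have "w \<noteq> b" using w \<sigma>(2)[OF s b] by metis
    ultimately show ?thesis using w unfolding C_def by auto
  qed
  moreover have "\<sigma> i a = a" if "(a, b, B) \<in> S" for a b B i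
    using \<sigma>(3) first[OF that] by blast
  ultimately show ?thesis using \<sigma>(1) by (intro exI[of _ \<sigma>]) blast
qed

text \<open>In a sum modulo 2 the known summands cancel, which leaves the one at
  \<open>i\<close>.\<close>

lemma odd_card_determines:
  assumes "finite A" "i \<in> A" "\<And>j. j \<in> A \<Longrightarrow> j \<noteq> i \<Longrightarrow> P j = P' j"
    and "odd (card {j \<in> A. P j}) = odd (card {j \<in> A. P' j})"
  shows "P i = P' i"
proof -
  have split: "card {j \<in> A. R j} = card {j \<in> A - {i}. R j} + of_bool (R i)" for R
  proof -
    have "{j \<in> A. R j} = {j \<in> A - {i}. R j} \<union> (if R i then {i} else {})"
      using assms(2) by auto
    then show ?thesis using assms(1) by (auto simp: card_insert_if)
  qed
  have "{j \<in> A - {i}. P j} = {j \<in> A - {i}. P' j}" using assms(3) by auto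
  then show ?thesis using assms(4) split[of P] split[of P'] by (auto split: if_splits)
qed

section \<open>The simulation\<close>

text \<open>\<open>\<sigma> i\<close> maps the roles of \<open>Q\<close> to the parties that play
  them in instance \<open>i\<close>. By \<open>\<sigma>_blind\<close>, whoever plays
  \<open>b\<close> in one filtered instance plays in the others only roles that \<open>a\<close>
  does not see.\<close>

locale filtered_simulation =
  fixes k n l :: nat
    and f :: "(nat \<Rightarrow> bool list) \<Rightarrow> bool"
    and E :: "(nat \<times> nat) set"
    and Q :: restricted_protocol
    and S :: "(nat \<times> nat \<times> nat set) set"
    and \<sigma> :: "nat \<Rightarrow> nat \<Rightarrow> nat"
  assumes symmetric: "symmetric_fun k n f"
    and graph: "restriction_graph k E"
    and obl: "oblivious k n E Q"
    and computes: "restricted_computes k n E Q f"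
    and filtering: "l_filtering_set l k E S"
    and \<sigma>_permutes: "\<sigma> i permutes parties k"
    and \<sigma>_sender: "(a, b, B) \<in> S \<Longrightarrow> \<sigma> i a = a"
    and \<sigma>_blind: "(a, b, B) \<in> S \<Longrightarrow> i \<le> card B \<Longrightarrow> j \<le> card B \<Longrightarrow> i \<noteq> j \<Longrightarrow>
      \<sigma> j v = \<sigma> i b \<Longrightarrow> v \<in> B"
begin

section \<open>Combinatorics of the filtering set\<close>

lemma S_D:
  assumes "(a, b, B) \<in> S"
  shows "a \<in> parties k" "b \<in> parties k" "a \<noteq> b" "B \<inter> nbrs E a = {}"
proof -
  have "S \<subseteq> {(a, b, B). a \<in> parties k \<and> b \<in> parties k \<and> a \<noteq> b \<and>
      B \<subseteq> non_nbrs k E a \<and> a \<notin> B \<and> b \<notin> B}"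
    using filtering unfolding l_filtering_set_def filtering_set_def by (elim conjE)
  from subsetD[OF this assms]
  show "a \<in> parties k" "b \<in> parties k" "a \<noteq> b" "B \<inter> nbrs E a = {}"
    unfolding non_nbrs_def by auto
qed

lemma S_distinct:
  assumes "(a, b, B) \<in> S" "(a', b', B') \<in> S" "(a, b, B) \<noteq> (a', b', B')"
  shows "a \<noteq> b'" "b \<noteq> b'"
proof -
  have "\<forall>(a, b, B)\<in>S. \<forall>(a', b', B')\<in>S. (a, b, B) \<noteq> (a', b', B') \<longrightarrow>
      a \<notin> {b'} \<union> B' \<and> ({b} \<union> B) \<inter> ({b'} \<union> B') = {}"
    using filtering unfolding l_filtering_set_def filtering_set_def by (elim conjE)
  from bspec[OF bspec[OF this assms(1), simplified prod.case] assms(2)] assms(3)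
  show "a \<noteq> b'" "b \<noteq> b'" by auto
qed

lemma S_unique:
  assumes "(a, b, B) \<in> S" "(a', b, B') \<in> S"
  shows "a' = a" "B' = B"
  using S_distinct(2)[OF assms] by auto

lemma sender_not_receiver: "(a, b, B) \<in> S \<Longrightarrow> (a', a, B') \<notin> S"
  using S_distinct(1) S_D(3) by blast

lemma finite_S: "finite S"
proof (rule finite_subset)
  show "S \<subseteq> parties k \<times> parties k \<times> Pow (parties k)"
    using filtering unfolding l_filtering_set_def filtering_set_def non_nbrs_def by blast
qed simp

text \<open>The sum has at most one summand, as \<open>S\<close> has at most one triple for each channel.\<close>

definition saving :: "nat \<Rightarrow> nat \<Rightarrow> nat" where
  "saving a b = (\<Sum>(a', b', B)\<in>{s \<in> S. fst s = a \<and> fst (snd s) = b}. card B)"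

lemma saving_eq:
  assumes s: "(a, b, B) \<in> S"
  shows "saving a b = card B"
proof -
  have "{s \<in> S. fst s = a \<and> fst (snd s) = b} = {(a, b, B)}"
  proof (intro equalityI subsetI)
    fix u assume "u \<in> {s \<in> S. fst s = a \<and> fst (snd s) = b}"
    then show "u \<in> {(a, b, B)}"
      using S_unique(2)[OF s, of a "snd (snd u)"] by (cases u) simp
  qed (use s in simp)
  then show ?thesis unfolding saving_def by simp
qed

lemma saving_nonzero: "saving a b \<noteq> 0 \<Longrightarrow> \<exists>B. (a, b, B) \<in> S"
proof (rule ccontr)
  assume "saving a b \<noteq> 0" "\<nexists>B. (a, b, B) \<in> S"
  moreover from this(2) have "{s \<in> S. fst s = a \<and> fst (snd s) = b} = {}" by auto
  ultimately show False unfolding saving_def by (metis sum.empty)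
qed

text \<open>A single triple contributes no more than the whole sum for \<open>a\<close>, which is at
  most \<open>R k S\<close>. The bound guarantees that the instances
  \<open>0, ..., saving a b\<close> exist; without a triple it still forces \<open>l\<close> to be
  positive.\<close>

lemma saving_less: "saving a b < l"
proof (cases "saving a b = 0")
  case True
  then show ?thesis using filtering unfolding l_filtering_set_def by linarith
next
  case False
  then obtain B where s: "(a, b, B) \<in> S" using saving_nonzero by blast
  have "saving a b = (\<Sum>(a', b', B')\<in>{(a, b, B)}. card B')" using saving_eq[OF s] by simp
  also have "\<dots> \<le> (\<Sum>(a', b', B')\<in>{s \<in> S. fst s = a}. card B')"
    using s finite_S by (intro sum_mono2) auto
  also have "\<dots> \<le> R k S" unfolding R_def using S_D(1)[OF s] by (intro Max_ge) auto
  finally show ?thesis using filtering unfolding l_filtering_set_def by linarith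
qed

section \<open>Instances with permuted roles\<close>

text \<open>In instance \<open>i\<close>, party \<open>\<sigma> i a\<close> plays the role of party \<open>a\<close> in \<open>Q\<close>.\<close>

definition inst :: "(nat \<Rightarrow> bool list list) \<Rightarrow> nat \<Rightarrow> nat \<Rightarrow> bool list" where
  "inst X i = (\<lambda>j\<in>parties k. X (\<sigma> i j) ! i)"

abbreviation "M \<equiv> inputs k (multi_words l n)"

lemma \<sigma>_parties: "\<sigma> i a \<in> parties k \<longleftrightarrow> a \<in> parties k"
  using permutes_in_image[OF \<sigma>_permutes] .

lemma nth_words: "X \<in> M \<Longrightarrow> i < l \<Longrightarrow> j \<in> parties k \<Longrightarrow> X j ! i \<in> words n"
  unfolding inputs_def multi_words_def by (fastforce dest: PiE_mem)

lemma inst_inputs: "X \<in> M \<Longrightarrow> i < l \<Longrightarrow> inst X i \<in> inputs k (words n)"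
  using nth_words \<sigma>_parties unfolding inst_def by (subst inputs_def) auto

text \<open>\<open>inst X i\<close> is instance \<open>i\<close> of the input with its arguments
  permuted by \<open>\<sigma> i\<close>, so this is where symmetry enters.\<close>

lemma f_inst:
  assumes "X \<in> M" "i < l"
  shows "f (inst X i) = multi_fun k l f X ! i"
proof -
  let ?x = "\<lambda>j\<in>parties k. X j ! i"
  have "?x \<in> inputs k (words n)" using nth_words[OF assms] by (subst inputs_def) auto
  then have "f (\<lambda>j. ?x (\<sigma> i j)) = f ?x"
    using symmetric \<sigma>_permutes unfolding symmetric_fun_def by blast
  moreover have "(\<lambda>j. ?x (\<sigma> i j)) = inst X i"
    unfolding inst_def using \<sigma>_parties by (auto simp del: atLeastAtMost_iff)
  ultimately show ?thesis using assms(2) unfolding multi_fun_def by simp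
qed

text \<open>Party \<open>c\<close> misses only its own argument, and role \<open>a\<close> does not
  look at it when the role played by \<open>c\<close> is no neighbour of \<open>a\<close>.\<close>

lemma graph_view_inst:
  assumes "nof_view k c X = nof_view k c Y" "\<And>v. v \<in> nbrs E a \<Longrightarrow> \<sigma> i v \<noteq> c"
  shows "graph_view E a (inst X i) = graph_view E a (inst Y i)"
proof -
  have "inst X i v = inst Y i v" if v: "v \<in> nbrs E a" for v
  proof (cases "v \<in> parties k")
    case True
    then have "\<sigma> i v \<in> parties k - {c}" using assms(2)[OF v] \<sigma>_parties by blast
    then have "X (\<sigma> i v) = Y (\<sigma> i v)"
      using assms(1) unfolding nof_view_def by (metis restrict_apply')
    then show ?thesis unfolding inst_def by simp
  next
    case False
    then show ?thesis unfolding inst_def restrict_def by (simp only: if_False)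
  qed
  then show ?thesis unfolding graph_view_def by (auto simp: restrict_def)
qed

section \<open>The bits on the board\<close>

definition msg_len :: "nat \<Rightarrow> nat \<Rightarrow> nat \<Rightarrow> nat" where
  "msg_len t a b = length (message k E Q (\<lambda>j\<in>parties k. replicate n False) t a b)"

lemma length_message:
  assumes "X \<in> M" "i < l" "t < rounds Q" "a \<in> parties k" "b \<in> parties k - {a}"
  shows "length (message k E Q (inst X i) t a b) = msg_len t a b"
  using obl assms inst_inputs zero_input unfolding oblivious_def msg_len_def by blast

lemma W_msg_len: "a \<in> parties k \<Longrightarrow> b \<in> parties k - {a} \<Longrightarrow>
    W k n E Q a b = (\<Sum>t<rounds Q. msg_len t a b)"
  using W_eq[OF obl _ _ _ zero_input, of a b] unfolding channel_bits_def msg_len_def by auto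

text \<open>Per bit of the channel from \<open>a\<close> to \<open>b\<close>, the board carries one bit for each slot
  \<open>s \<in> {saving a b..<l}\<close>: the first slot holds the sum modulo 2 over the instances
  \<open>0, \<dots>, saving a b\<close>, and every other slot holds the bit of a single instance.\<close>

definition slot :: "nat \<Rightarrow> nat \<Rightarrow> nat \<Rightarrow> nat set" where
  "slot a b s = (if s = saving a b then {..s} else {s})"

fun channel_bit :: "nat \<times> nat \<times> nat \<times> nat \<times> nat \<Rightarrow> (nat \<Rightarrow> bool list list) \<Rightarrow> bool" where
  "channel_bit (t, a, b, s, p) X \<longleftrightarrow>
    odd (card {i \<in> slot a b s. message k E Q (inst X i) t a b ! p})"

text \<open>The coordinates are the round, counted from 0, the sending role, the receiving role, the
  slot and the position in the message.\<close>

definition channel_index :: "(nat \<times> nat \<times> nat \<times> nat \<times> nat) set" where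
  "channel_index = (SIGMA t:{..<rounds Q}. SIGMA a:parties k. SIGMA b:parties k - {a}.
    {saving a b..<l} \<times> {..<msg_len t a b})"

text \<open>Knowledge is expressed by indistinguishability: a quantity can be read off the first
  \<open>t\<close> rounds of the board if it is equal on any two inputs that agree up to
  \<open>t\<close>. No decoding functions have to be defined.\<close>

definition agree :: "nat \<Rightarrow> (nat \<Rightarrow> bool list list) \<Rightarrow> (nat \<Rightarrow> bool list list) \<Rightarrow> bool" where
  "agree t X Y \<longleftrightarrow> (\<forall>q\<in>channel_index. fst q < t \<longrightarrow> channel_bit q X = channel_bit q Y)"

lemma agree_mono: "agree t X Y \<Longrightarrow> t' \<le> t \<Longrightarrow> agree t' X Y"
  unfolding agree_def by auto

text \<open>An instance beyond \<open>saving a b\<close> has a slot of its own. In the shared slot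
  the other messages are known by \<open>others\<close>, so the parity yields that of instance
  \<open>i\<close>.\<close>

lemma agree_message:
  assumes XY: "X \<in> M" "Y \<in> M" and agree: "agree (Suc t) X Y" and ti: "t < rounds Q" "i < l"
    and ab: "a \<in> parties k" "b \<in> parties k - {a}"
    and others: "\<And>j. j \<le> saving a b \<Longrightarrow> i \<le> saving a b \<Longrightarrow> j \<noteq> i \<Longrightarrow>
      message k E Q (inst X j) t a b = message k E Q (inst Y j) t a b"
  shows "message k E Q (inst X i) t a b = message k E Q (inst Y i) t a b"
proof (rule nth_equalityI)
  note len = length_message[OF _ ti(2,1) ab]
  show "length (message k E Q (inst X i) t a b) = length (message k E Q (inst Y i) t a b)"
    unfolding len[OF XY(1)] len[OF XY(2)] ..
  fix p assume "p < length (message k E Q (inst X i) t a b)"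
  then have p: "p < msg_len t a b" unfolding len[OF XY(1)] .
  \<comment> \<open>The slot containing \<open>i\<close>: the shared one if
    \<open>i \<le> saving a b\<close>, otherwise that of \<open>i\<close> alone.\<close>
  let ?s = "max i (saving a b)"
  have i: "i \<in> slot a b ?s" unfolding slot_def by auto
  have fin: "finite (slot a b ?s)" unfolding slot_def by auto
  have "(t, a, b, ?s, p) \<in> channel_index"
    unfolding channel_index_def using ti ab p saving_less by auto
  then have "channel_bit (t, a, b, ?s, p) X = channel_bit (t, a, b, ?s, p) Y"
    using agree unfolding agree_def by auto
  then have "odd (card {j \<in> slot a b ?s. message k E Q (inst X j) t a b ! p}) =
      odd (card {j \<in> slot a b ?s. message k E Q (inst Y j) t a b ! p})" by simp
  moreover have "message k E Q (inst X j) t a b ! p = message k E Q (inst Y j) t a b ! p"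
    if "j \<in> slot a b ?s" "j \<noteq> i" for j
    using others[of j] that unfolding slot_def by (auto simp: max_def split: if_splits)
  ultimately show "message k E Q (inst X i) t a b ! p = message k E Q (inst Y i) t a b ! p"
    using odd_card_determines[OF fin i, of "\<lambda>j. message k E Q (inst X j) t a b ! p"
        "\<lambda>j. message k E Q (inst Y j) t a b ! p"] by simp
qed

lemma received_Suc_cong:
  assumes "received k E Q x t a = received k E Q y t a"
    and "\<And>b. b \<in> parties k - {a} \<Longrightarrow> message k E Q x t b a = message k E Q y t b a"
  shows "received k E Q x (Suc t) a = received k E Q y (Suc t) a"
  using assms unfolding message_def by auto

text \<open>Nothing that is sent to the first component of a triple is filtered, so the history of
  that role can be read off the board.\<close>

lemma agree_received_sender:
  assumes XY: "X \<in> M" "Y \<in> M" and "agree t X Y" "t \<le> rounds Q" "i < l" "(a, b, B) \<in> S"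
  shows "received k E Q (inst X i) t a = received k E Q (inst Y i) t a"
  using assms(3,4)
proof (induction t)
  case (Suc t)
  show ?case
  proof (rule received_Suc_cong)
    show "received k E Q (inst X i) t a = received k E Q (inst Y i) t a"
      by (rule Suc.IH[OF agree_mono[OF Suc.prems(1)]]) (use Suc.prems(2) in simp_all)
    fix c assume c: "c \<in> parties k - {a}"
    have "saving c a = 0" using saving_nonzero sender_not_receiver[OF assms(6)] by blast
    then show "message k E Q (inst X i) t c a = message k E Q (inst Y i) t c a"
      using Suc.prems(2) c S_D(1)[OF assms(6)]
      by (intro agree_message[OF XY Suc.prems(1) _ assms(5)]) auto
  qed
qed simp

text \<open>The party that plays \<open>b\<close> in instance \<open>i \<le> card B\<close> plays in each other instance
  \<open>j \<le> card B\<close> a role in \<open>B\<close>, which \<open>a\<close> does not see. So it knows the message from \<open>a\<close> to \<open>b\<close>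
  in instance \<open>j\<close>, and the sum modulo 2 tells it the one in instance \<open>i\<close>.\<close>

lemma agree_received:
  assumes XY: "X \<in> M" "Y \<in> M" and "agree t X Y" "t \<le> rounds Q" "i < l" "b \<in> parties k"
    and view: "nof_view k (\<sigma> i b) X = nof_view k (\<sigma> i b) Y"
  shows "received k E Q (inst X i) t b = received k E Q (inst Y i) t b"
  using assms(3,4)
proof (induction t)
  case (Suc t)
  have agree_t: "agree t X Y" using Suc.prems(1) by (rule agree_mono) simp
  show ?case
  proof (rule received_Suc_cong)
    show "received k E Q (inst X i) t b = received k E Q (inst Y i) t b"
      by (rule Suc.IH[OF agree_t]) (use Suc.prems(2) in simp)
    fix a assume a: "a \<in> parties k - {b}"
    show "message k E Q (inst X i) t a b = message k E Q (inst Y i) t a b"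
    proof (rule agree_message[OF XY Suc.prems(1) _ assms(5)])
      fix j assume j: "j \<le> saving a b" "i \<le> saving a b" "j \<noteq> i"
      \<comment> \<open>Two distinct indices up to \<open>saving a b\<close> force it to be
        nonzero.\<close>
      then obtain B where s: "(a, b, B) \<in> S" using saving_nonzero[of a b] by auto
      have "\<sigma> j v \<noteq> \<sigma> i b" if "v \<in> nbrs E a" for v
        using \<sigma>_blind[OF s, of i j v] j saving_eq[OF s] S_D(4)[OF s] that by auto
      then have "graph_view E a (inst X j) = graph_view E a (inst Y j)"
        by (rule graph_view_inst[OF view])
      moreover have "received k E Q (inst X j) t a = received k E Q (inst Y j) t a"
        using agree_received_sender[OF XY agree_t _ _ s] Suc.prems(2) j saving_less[of a b] by simp
      ultimately show "message k E Q (inst X j) t a b = message k E Q (inst Y j) t a b"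
        unfolding message_def by simp
    qed (use Suc.prems(2) assms(6) a in auto)
  qed
qed simp

text \<open>Without loops, role \<open>a\<close> does not see the argument at its own index, which
  is the one on the forehead of its player.\<close>

lemma agree_graph_view:
  assumes "nof_view k (\<sigma> i a) X = nof_view k (\<sigma> i a) Y"
  shows "graph_view E a (inst X i) = graph_view E a (inst Y i)"
proof (rule graph_view_inst[OF assms])
  fix v assume "v \<in> nbrs E a"
  then have "v \<noteq> a" using graph unfolding restriction_graph_def nbrs_def irrefl_def by auto
  then show "\<sigma> i v \<noteq> \<sigma> i a" using permutes_inj[OF \<sigma>_permutes] by (metis injD)
qed

text \<open>The speaker \<open>\<sigma> s a\<close> knows every summand because it plays
  \<open>a\<close> in all instances of the slot: the sender of a triple is never moved, and without
  a triple the slot is a single instance.\<close>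

lemma channel_bit_determined:
  assumes XY: "X \<in> M" "Y \<in> M" and "agree t X Y" and q: "(t, a, b, s, p) \<in> channel_index"
    and view: "nof_view k (\<sigma> s a) X = nof_view k (\<sigma> s a) Y"
  shows "channel_bit (t, a, b, s, p) X = channel_bit (t, a, b, s, p) Y"
proof -
  have q: "t < rounds Q" "a \<in> parties k" "s < l"
    using q unfolding channel_index_def by auto
  have "message k E Q (inst X i) t a b = message k E Q (inst Y i) t a b"
    if i: "i \<in> slot a b s" for i
  proof -
    have eq: "\<sigma> i a = \<sigma> s a"
    proof (cases "saving a b = 0")
      case True
      then show ?thesis using i unfolding slot_def by (auto split: if_splits)
    next
      case False
      then obtain B where "(a, b, B) \<in> S" using saving_nonzero by blast
      then show ?thesis using \<sigma>_sender by metis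
    qed
    have "i < l" using i q(3) unfolding slot_def by (auto split: if_splits)
    then show ?thesis
      unfolding message_def
      using agree_received[OF XY assms(3) _ _ q(2) view[folded eq]]
        agree_graph_view[OF view[folded eq]] q(1)
      by simp
  qed
  then have "{i \<in> slot a b s. message k E Q (inst X i) t a b ! p} =
      {i \<in> slot a b s. message k E Q (inst Y i) t a b ! p}"
    by (intro Collect_cong conj_cong refl) simp
  then show ?thesis by simp
qed

text \<open>After the last round, the designated party writes the outcome of each instance.\<close>

lemma D_NOF_le_card_channel_index:
  "D_NOF k (multi_words l n) (multi_fun k l f) \<le> enat (card channel_index + l)"
proof -
  define speaker where
    "speaker q = (case q of Inl (t, a, b, s, p) \<Rightarrow> \<sigma> s a | Inr i \<Rightarrow> \<sigma> i (designated Q))"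
    for q :: "(nat \<times> nat \<times> nat \<times> nat \<times> nat) + nat"
  \<comment> \<open>Channel bits have ranks below \<open>rounds Q\<close>, so the outcomes come
    after all of them.\<close>
  define rank where "rank q = (case q of Inl q \<Rightarrow> fst q | Inr i \<Rightarrow> rounds Q)"
    for q :: "(nat \<times> nat \<times> nat \<times> nat \<times> nat) + nat"
  define bit where "bit q X = (case q of Inl q \<Rightarrow> channel_bit q X | Inr i \<Rightarrow> f (inst X i))"
    for q X
  have des: "designated Q \<in> parties k" using computes unfolding restricted_computes_def by blast
  have fin: "finite channel_index" unfolding channel_index_def by auto
  have "D_NOF k (multi_words l n) (multi_fun k l f) \<le> enat (card (channel_index <+> {..<l}))"
  proof (rule D_NOF_le_card_bits[where speaker = speaker and rank = rank and bit = bit])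
    show "finite (channel_index <+> {..<l})" using fin by simp
    show "speaker ` (channel_index <+> {..<l}) \<subseteq> parties k"
      using \<sigma>_parties des unfolding speaker_def channel_index_def by fastforce
  next
    fix q X Y
    assume q: "q \<in> channel_index <+> {..<l}" and XY: "X \<in> M" "Y \<in> M"
      and view: "nof_view k (speaker q) X = nof_view k (speaker q) Y"
      and lower: "\<And>r. r \<in> channel_index <+> {..<l} \<Longrightarrow> rank r < rank q \<Longrightarrow> bit r X = bit r Y"
    have agree: "agree (rank q) X Y" unfolding agree_def
    proof (intro ballI impI)
      fix r assume "r \<in> channel_index" "fst r < rank q"
      then show "channel_bit r X = channel_bit r Y"
        using lower[of "Inl r", OF InlI] unfolding rank_def bit_def by simp
    qed
    show "bit q X = bit q Y"
    proof (cases q)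
      case (Inl r)
      obtain t a b s p where r: "r = (t, a, b, s, p)" by (cases r) auto
      then show ?thesis
        using channel_bit_determined[OF XY, of t a b s p] agree view q Inl
        unfolding rank_def bit_def speaker_def by auto
    next
      case (Inr i)
      have i: "i < l" using q Inr by auto
      have view: "nof_view k (\<sigma> i (designated Q)) X = nof_view k (\<sigma> i (designated Q)) Y"
        using view Inr unfolding speaker_def by simp
      have "agree (rounds Q) X Y" using agree Inr unfolding rank_def by simp
      then have "received k E Q (inst X i) (rounds Q) (designated Q) =
          received k E Q (inst Y i) (rounds Q) (designated Q)"
        using agree_received[OF XY _ _ i des view] by simp
      then have "f (inst X i) = f (inst Y i)"
        using computes inst_inputs[OF _ i] XY agree_graph_view[OF view]
        unfolding restricted_computes_def by metis
      then show ?thesis using Inr unfolding bit_def by simp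
    qed
  next
    fix X Y
    assume XY: "X \<in> M" "Y \<in> M"
      and bits: "\<And>q. q \<in> channel_index <+> {..<l} \<Longrightarrow> bit q X = bit q Y"
    have "multi_fun k l f X ! i = multi_fun k l f Y ! i" if "i < l" for i
      using bits[of "Inr i"] f_inst XY that unfolding bit_def by auto
    then show "multi_fun k l f X = multi_fun k l f Y"
      by (intro nth_equalityI) (auto simp: multi_fun_def)
  qed
  also have "card (channel_index <+> {..<l}) = card channel_index + l"
    using fin by (simp add: card_Plus)
  finally show ?thesis .
qed

section \<open>Counting the bits\<close>

lemma card_channel_index:
  "card channel_index = (\<Sum>a\<in>parties k. \<Sum>b\<in>parties k - {a}. (l - saving a b) * W k n E Q a b)"
proof -
  have "card channel_index =
      (\<Sum>t<rounds Q. \<Sum>a\<in>parties k. \<Sum>b\<in>parties k - {a}. (l - saving a b) * msg_len t a b)"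
    unfolding channel_index_def by (simp add: card_SigmaI card_cartesian_product)
  \<comment> \<open>The sum over rounds is moved innermost, where it collects the message lengths of
    a channel into \<open>W\<close>.\<close>
  also have "\<dots> =
      (\<Sum>a\<in>parties k. \<Sum>t<rounds Q. \<Sum>b\<in>parties k - {a}. (l - saving a b) * msg_len t a b)"
    by (rule sum.swap)
  also have "\<dots> =
      (\<Sum>a\<in>parties k. \<Sum>b\<in>parties k - {a}. \<Sum>t<rounds Q. (l - saving a b) * msg_len t a b)"
    by (intro sum.cong refl sum.swap)
  also have "\<dots> = (\<Sum>a\<in>parties k. \<Sum>b\<in>parties k - {a}. (l - saving a b) * W k n E Q a b)"
    by (intro sum.cong refl) (simp add: W_msg_len sum_distrib_left)
  finally show ?thesis .
qed

text \<open>As \<open>saving\<close> is itself a sum over the triples of a channel, this only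
  regroups \<open>S\<close> by channels.\<close>

lemma sum_saving:
  "(\<Sum>a\<in>parties k. \<Sum>b\<in>parties k - {a}. real (saving a b) * real (W k n E Q a b)) =
    (\<Sum>(a, b, B)\<in>S. real (card B) * real (W k n E Q a b))"
proof -
  let ?P = "SIGMA a:parties k. parties k - {a}"
  let ?g = "\<lambda>(a, b, B). real (card B) * real (W k n E Q a b)"
  have "(\<Sum>a\<in>parties k. \<Sum>b\<in>parties k - {a}. real (saving a b) * real (W k n E Q a b)) =
      (\<Sum>(a, b)\<in>?P. real (saving a b) * real (W k n E Q a b))"
    by (rule sum.Sigma) auto
  also have "\<dots> = (\<Sum>c\<in>?P. \<Sum>s\<in>{s \<in> S. (fst s, fst (snd s)) = c}. ?g s)"
  proof (rule sum.cong[OF refl])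
    fix c assume "c \<in> ?P"
    obtain a b where c: "c = (a, b)" by (cases c)
    have "{s \<in> S. (fst s, fst (snd s)) = c} = {s \<in> S. fst s = a \<and> fst (snd s) = b}"
      using c by auto
    moreover have "real (saving a b) * real (W k n E Q a b) =
        (\<Sum>s\<in>{s \<in> S. fst s = a \<and> fst (snd s) = b}. ?g s)"
      unfolding saving_def of_nat_sum sum_distrib_right
      by (intro sum.cong refl) auto
    ultimately show "(case c of (a, b) \<Rightarrow> real (saving a b) * real (W k n E Q a b)) =
        (\<Sum>s\<in>{s \<in> S. (fst s, fst (snd s)) = c}. ?g s)" using c by simp
  qed
  also have "\<dots> = (\<Sum>s\<in>S. ?g s)"
  proof (rule sum.group)
    show "(\<lambda>s. (fst s, fst (snd s))) ` S \<subseteq> ?P" using S_D by fastforce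
  qed (use finite_S in auto)
  finally show ?thesis .
qed

lemma real_card_channel_index:
  "real (card channel_index) = real l * real (D_restricted k n E Q)
    - (\<Sum>(a, b, B)\<in>S. real (card B) * real (W k n E Q a b))"
proof -
  have "real (card channel_index) = (\<Sum>a\<in>parties k. \<Sum>b\<in>parties k - {a}.
      real l * real (W k n E Q a b) - real (saving a b) * real (W k n E Q a b))"
    \<comment> \<open>By \<open>saving_less\<close> the truncated subtraction agrees with the real
      one.\<close>
    unfolding card_channel_index of_nat_sum of_nat_mult
    by (intro sum.cong refl)
      (simp add: of_nat_diff less_imp_le[OF saving_less] left_diff_distrib)
  also have "\<dots> = real l * real (D_restricted k n E Q) -
      (\<Sum>a\<in>parties k. \<Sum>b\<in>parties k - {a}. real (saving a b) * real (W k n E Q a b))"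
    unfolding D_restricted_eq[OF obl] by (simp add: sum_subtractf sum_distrib_left)
  finally show ?thesis unfolding sum_saving .
qed

end

theorem theorem2:
  fixes k n l :: nat
    and f :: "(nat \<Rightarrow> bool list) \<Rightarrow> bool"
    and E :: "(nat \<times> nat) set"
    and Q :: restricted_protocol
    and S :: "(nat \<times> nat \<times> nat set) set"
  assumes "symmetric_fun k n f"
    and "restriction_graph k E"
    and "oblivious k n E Q"
    and "restricted_computes k n E Q f"
    and "l_filtering_set l k E S"
  shows "ereal_of_enat (D_NOF k (multi_words l n) (multi_fun k l f))
    \<le> ereal (real l * real (D_restricted k n E Q) + real l
        - (\<Sum>(a, b, B)\<in>S. real (card B) * real (W k n E Q a b)))"
proof -
  have "filtering_set k E S" using assms(5) unfolding l_filtering_set_def by (rule conjunct1)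
  from filtering_set_permutations[OF this] obtain \<sigma> where \<sigma>: "\<forall>i. \<sigma> i permutes parties k"
    "\<forall>(a, b, B)\<in>S. \<forall>i. \<sigma> i a = a"
    "\<forall>(a, b, B)\<in>S. \<forall>i\<le>card B. \<forall>j\<le>card B. \<forall>v. i \<noteq> j \<longrightarrow> \<sigma> j v = \<sigma> i b \<longrightarrow> v \<in> B"
    by (elim exE conjE) (rule that)
  interpret filtered_simulation k n l f E Q S \<sigma>
  proof (unfold_locales, (fact assms)+)
    fix i j v :: nat and a b :: nat and B :: "nat set"
    show "\<sigma> i permutes parties k" using \<sigma>(1) by blast
    assume s: "(a, b, B) \<in> S"
    show "\<sigma> i a = a" using bspec[OF \<sigma>(2) s] by simp
    assume "i \<le> card B" "j \<le> card B" "i \<noteq> j" "\<sigma> j v = \<sigma> i b"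
    then show "v \<in> B" using bspec[OF \<sigma>(3) s] by (simp only: prod.case) blast
  qed
  have "ereal_of_enat (D_NOF k (multi_words l n) (multi_fun k l f)) \<le>
      ereal_of_enat (enat (card channel_index + l))"
    using D_NOF_le_card_channel_index by (simp only: ereal_of_enat_le_iff)
  then show ?thesis by (simp add: real_card_channel_index algebra_simps)
qed

end
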